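(* Let $\mu=(\mu_1,\dots,\mu_N)\in\mathcal{P}_\delta$ and let $X_1,\dots,X_N$ be independent random variables such that $X_i\sim\mu_i$ for every $i$; put $X=(X_1,\dots,X_N)$. Under Assumption 1 (recalled in the context), $$\mathbb{E}[J(X)]-\mathcal{J}(\mu)\ \le\ \frac{1}{2N^2}\sum_{j=1}^M\Big(\tilde L_j\sum_{i=1}^N\sigma^2_{\mu_i}[g_{ij}]\Big)\ \le\ \frac{C_1}{2N}.$$ As a consequence, $J^*-\mathcal{J}^*\le \frac{C_1}{2N}$.
   Context: Setting. $N,M\ge1$ are integers; $\mathcal{X}_1,\dots,\mathcal{X}_N$ are nonempty sets and $\mathcal{X}=\prod_{i=1}^N\mathcal{X}_i$; $\mathcal{E}_1,\dots,\mathcal{E}_M$ are separable real Hilbert spaces and $\mathcal{E}=\prod_{j=1}^M\mathcal{E}_j$ with scalar product $\langle y,y'\rangle=\sum_j\langle y_j,y_j'\rangle_{\mathcal{E}_j}$. For each $i,j$ we are given maps $g_{ij}:\mathcal{X}_i\to\mathcal{E}_j$ and $f_j:\mathcal{E}_j\to\mathbb{R}$; $g_i=(g_{ij})_{j=1,\dots,M}:\mathcal{X}_i\to\mathcal{E}$ and $f(y)=\sum_{j=1}^M f_j(y_j)$. The cost is $J(x)=f\big(\frac1N\sum_{i=1}^N g_i(x_i)\big)=\sum_{j=1}^M f_j\big(\frac1N\sum_{i=1}^N g_{ij}(x_i)\big)$ for $x\in\mathcal{X}$, and $J^*=\inf_{x\in\mathcal{X}}J(x)$. Randomized problem. For a set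 $\Omega$, $\mathcal{P}_\delta(\Omega)$ is the set of finitely supported probability measures $\sum_{k=1}^K\lambda_k\delta_{x_k}$ on $\Omega$. For $\mu=\sum_k\lambda_k\delta_{x_k}\in\mathcal{P}_\delta(\Omega)$ and $F:\Omega\to\mathcal{H}$ with $\mathcal{H}$ a Hilbert space, $E_\mu[F]=\sum_k\lambda_kF(x_k)$ and $\sigma_\mu^2[F]=\sum_k\lambda_k\|F(x_k)-E_\mu[F]\|_{\mathcal{H}}^2$. Put $\mathcal{P}_\delta=\prod_{i=1}^N\mathcal{P}_\delta(\mathcal{X}_i)$, $\mathcal{J}(\mu)=f\big(\frac1N\sum_{i=1}^NE_{\mu_i}[g_i]\big)$ and $\mathcal{J}^*=\inf_{\mu\in\mathcal{P}_\delta}\mathcal{J}(\mu)$. The notation $X\sim\mu$ means that $\mu$ is the distribution of $X$. Assumption 1. Let $S_{ij}=g_{ij}(\mathcal{X}_i)$ and $S_j=\frac1N\sum_{i=1}^NS_{ij}$ (Minkowski sum). For all $i,j$: (1) $S_{ij}$ has finite diameter $d_{ij}$; (2) $f_j$ is $L_j$-Lipschitz on $\mathrm{conv}(S_j)$; (3) $f_j$ is continuously differentiable on a neighborhood of $\mathrm{conv}(S_j)$ and $\nabla f_j$ is $\tilde L_j$-Lipschitz on $\mathrm{conv}(S_j)$. Constant: $C_1=\frac1N\sum_{j=1}^M\big(\tilde L_j\sum_{i=1}^Nd_{ij}^2\big)$. *)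

theory Defs
  imports "HOL-Probability.Probability"
begin

text \<open>
  The integers \<open>N, M \<ge> 1\<close> are the cardinalities of the finite index types \<open>'n\<close> and \<open>'m\<close>.
  The sets of the family \<open>X i\<close> are subsets of one common type \<open>'x\<close>, and the separable
  Hilbert spaces of the family \<open>E j\<close>, which may differ from each other, are closed subspaces of
  one common separable Hilbert space \<open>'e\<close>. Nothing is lost: a family of sets embeds into
  its disjoint union, a finite family of separable Hilbert spaces into its Hilbert sum.
  The product of the \<open>E j\<close> lies in \<open>'e ^ 'm\<close>, whose inner product is the sum of the
  componentwise ones. Only the values of \<open>f j\<close> on \<open>E j\<close> and of \<open>g i j\<close> on \<open>X i\<close> matter.
\<close>

definition gvec :: "('m \<Rightarrow> 'x \<Rightarrow> 'e) \<Rightarrow> 'x \<Rightarrow> 'e ^ 'm::finite"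
  where "gvec G x = (\<chi> j. G j x)"

definition separable_sum :: "('m \<Rightarrow> 'e \<Rightarrow> real) \<Rightarrow> 'e ^ 'm::finite \<Rightarrow> real"
  where "separable_sum f y = (\<Sum>j\<in>UNIV. f j (y $ j))"

definition cost ::
  "('m::finite \<Rightarrow> 'e::real_inner \<Rightarrow> real) \<Rightarrow> ('n \<Rightarrow> 'm \<Rightarrow> 'x \<Rightarrow> 'e) \<Rightarrow> ('n::finite \<Rightarrow> 'x) \<Rightarrow> real"
  where "cost f g x =
    separable_sum f ((1 / real CARD('n)) *\<^sub>R (\<Sum>i\<in>UNIV. gvec (g i) (x i)))"

text \<open>
  A finitely supported measure \<open>\<Sum>\<^sub>k \<lambda>\<^sub>k \<delta>\<^bsub>x\<^sub>k\<^esub>\<close> is represented with the \<open>x\<^sub>k\<close> being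
  its distinct support points, so that \<open>\<lambda>\<^sub>k = pmf \<mu> x\<^sub>k\<close>.
\<close>

definition fin_pmfs :: "'x set \<Rightarrow> 'x pmf set"
  where "fin_pmfs A = {\<mu>. finite (set_pmf \<mu>) \<and> set_pmf \<mu> \<subseteq> A}"

definition mean :: "'x pmf \<Rightarrow> ('x \<Rightarrow> 'h::real_inner) \<Rightarrow> 'h"
  where "mean \<mu> F = (\<Sum>x\<in>set_pmf \<mu>. pmf \<mu> x *\<^sub>R F x)"

definition var :: "'x pmf \<Rightarrow> ('x \<Rightarrow> 'h::real_inner) \<Rightarrow> real"
  where "var \<mu> F = (\<Sum>x\<in>set_pmf \<mu>. pmf \<mu> x * (norm (F x - mean \<mu> F))\<^sup>2)"

definition rand_cost ::
  "('m::finite \<Rightarrow> 'e::real_inner \<Rightarrow> real) \<Rightarrow> ('n \<Rightarrow> 'm \<Rightarrow> 'x \<Rightarrow> 'e) \<Rightarrow> ('n::finite \<Rightarrow> 'x pmf) \<Rightarrow> real"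
  where "rand_cost f g \<mu> =
    separable_sum f ((1 / real CARD('n)) *\<^sub>R (\<Sum>i\<in>UNIV. mean (\<mu> i) (gvec (g i))))"

text \<open>
  Under \<open>assumption1\<close> below, both infima are finite: the index sets are nonempty, and each \<open>f j\<close> is
  Lipschitz on a bounded set containing all points at which it is evaluated.
\<close>

definition opt_cost ::
  "('n::finite \<Rightarrow> 'x set) \<Rightarrow> ('m::finite \<Rightarrow> 'e::real_inner \<Rightarrow> real) \<Rightarrow> ('n \<Rightarrow> 'm \<Rightarrow> 'x \<Rightarrow> 'e) \<Rightarrow> real"
  where "opt_cost X f g = (INF x\<in>(\<Pi> i\<in>UNIV. X i). cost f g x)"

definition opt_rand_cost ::
  "('n::finite \<Rightarrow> 'x set) \<Rightarrow> ('m::finite \<Rightarrow> 'e::real_inner \<Rightarrow> real) \<Rightarrow> ('n \<Rightarrow> 'm \<Rightarrow> 'x \<Rightarrow> 'e) \<Rightarrow> real"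
  where "opt_rand_cost X f g = (INF \<mu>\<in>(\<Pi> i\<in>UNIV. fin_pmfs (X i)). rand_cost f g \<mu>)"

definition mink_avg ::
  "('n::finite \<Rightarrow> 'x set) \<Rightarrow> ('n \<Rightarrow> 'm \<Rightarrow> 'x \<Rightarrow> 'e::real_vector) \<Rightarrow> 'm \<Rightarrow> 'e set"
  where "mink_avg X g j =
    {(1 / real CARD('n)) *\<^sub>R (\<Sum>i\<in>UNIV. s i) | s. \<forall>i. s i \<in> g i j ` X i}"

text \<open>
  Frechet gradient of the restriction of \<open>f\<close> to the Hilbert space \<open>E\<close> (a closed subspace):
  the derivative is taken within \<open>E\<close> and represented by a vector of \<open>E\<close>, which is then unique.
\<close>

definition has_gradient_in :: "'e set \<Rightarrow> ('e \<Rightarrow> real) \<Rightarrow> 'e::real_inner \<Rightarrow> 'e \<Rightarrow> bool"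
  where "has_gradient_in E f v y \<longleftrightarrow>
    v \<in> E \<and> (f has_derivative (\<lambda>h. v \<bullet> h)) (at y within E)"

definition gradient_in :: "'e set \<Rightarrow> ('e \<Rightarrow> real) \<Rightarrow> 'e::real_inner \<Rightarrow> 'e"
  where "gradient_in E f y = (THE v. has_gradient_in E f v y)"

definition C1_on_nbhd_in :: "'e set \<Rightarrow> 'e set \<Rightarrow> ('e::real_inner \<Rightarrow> real) \<Rightarrow> bool"
  where "C1_on_nbhd_in E K f \<longleftrightarrow>
    (\<exists>U. openin (top_of_set E) U \<and> K \<subseteq> U \<and>
         (\<forall>y\<in>U. \<exists>v. has_gradient_in E f v y) \<and> continuous_on U (gradient_in E f))"

definition assumption1 ::
  "('n::finite \<Rightarrow> 'x set) \<Rightarrow> ('m::finite \<Rightarrow> 'e::real_inner set) \<Rightarrow> ('m \<Rightarrow> 'e \<Rightarrow> real) \<Rightarrow>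
    ('n \<Rightarrow> 'm \<Rightarrow> 'x \<Rightarrow> 'e) \<Rightarrow> ('m \<Rightarrow> real) \<Rightarrow> ('m \<Rightarrow> real) \<Rightarrow> bool"
  where "assumption1 X E f g L L' \<longleftrightarrow>
    (\<forall>i j. bounded (g i j ` X i)) \<and>
    (\<forall>j. (L j)-lipschitz_on (convex hull mink_avg X g j) (f j)) \<and>
    (\<forall>j. C1_on_nbhd_in (E j) (convex hull mink_avg X g j) (f j) \<and>
         (L' j)-lipschitz_on (convex hull mink_avg X g j) (gradient_in (E j) (f j)))"

definition C1_const ::
  "('n::finite \<Rightarrow> 'x set) \<Rightarrow> ('n \<Rightarrow> 'm::finite \<Rightarrow> 'x \<Rightarrow> 'e::real_inner) \<Rightarrow> ('m \<Rightarrow> real) \<Rightarrow> real"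
  where "C1_const X g L' =
    1 / real CARD('n) * (\<Sum>j\<in>UNIV. L' j * (\<Sum>i\<in>UNIV. (diameter (g i j ` X i))\<^sup>2))"

end

(*
  Fix j, let m be the average of the means E[g_ij] and Y the average of the g_ij(X_i). Both lie in
  conv(S_j), because the convex hull of a Minkowski sum is the sum of the convex hulls. Since the
  gradient is Lipschitz on this convex set,
    f_j(Y) <= f_j(m) + <grad f_j(m), Y - m> + L'_j/2 |Y - m|^2.
  Taking expectations kills the linear term, and independence turns E|Y - m|^2 into N^-2 times
  the sum of the variances. For the infima, J* <= J(X) holds surely, for independent X_i ~ mu_i.
*)
theory Submission
  imports Defs
begin

section \<open>Gradients relative to a subspace and the quadratic upper bound\<close>

text \<open>A line through a point of \<open>E\<close> in a direction of \<open>E\<close> stays in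
  \<open>E\<close>, so the derivative within \<open>E\<close> composes with it to an ordinary
  derivative on the real line. This reduces work with \<open>has_gradient_in\<close> to calculus in
  one variable.\<close>

lemma has_gradient_in_line:
  fixes E :: "'e::real_inner set"
  assumes E: "subspace E" "a \<in> E" "h \<in> E" and v: "has_gradient_in E f v (a + t *\<^sub>R h)"
  shows "((\<lambda>s. f (a + s *\<^sub>R h)) has_real_derivative v \<bullet> h) (at t)"
proof -
  let ?p = "\<lambda>s. a + s *\<^sub>R h"
  have p: "(?p has_derivative (\<lambda>s. s *\<^sub>R h)) (at t)"
    by (auto intro!: derivative_eq_intros)
  have "range ?p \<subseteq> E"
    using E by (auto intro: subspace_add subspace_scale)
  then have "(f has_derivative (\<lambda>h. v \<bullet> h)) (at (?p t) within range ?p)"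
    using v unfolding has_gradient_in_def by (blast intro: has_derivative_subset)
  from has_derivative_in_compose[OF p this] show ?thesis
    by (simp add: has_field_derivative_def mult_commute_abs)
qed

text \<open>Two candidates \<open>v\<close> and \<open>w\<close> pair equally with
  \<open>w - v\<close>, which itself lies in \<open>E\<close>; hence it has norm zero. This
  uniqueness gives access to the description in \<open>gradient_in\<close>.\<close>

lemma gradient_in_eq:
  fixes E :: "'e::real_inner set"
  assumes E: "subspace E" "y \<in> E" and v: "has_gradient_in E f v y"
  shows "gradient_in E f y = v"
  unfolding gradient_in_def
proof (rule the_equality)
  fix w assume w: "has_gradient_in E f w y"
  have h: "w - v \<in> E"
    using E v w by (auto simp: has_gradient_in_def intro: subspace_diff)
  \<comment> \<open>The right-hand side is free of \<open>u\<close>, so it forces all gradients at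
    \<open>y\<close> to agree in the direction \<open>w - v\<close>.\<close>
  have "u \<bullet> (w - v) = frechet_derivative (\<lambda>s. f (y + s *\<^sub>R (w - v))) (at 0) 1"
    if "has_gradient_in E f u y" for u
  proof -
    have "((\<lambda>s. f (y + s *\<^sub>R (w - v))) has_real_derivative u \<bullet> (w - v)) (at 0)"
      by (rule has_gradient_in_line[OF E h]) (simp add: that)
    then show ?thesis
      by (metis frechet_derivative_at has_field_derivative_def mult.right_neutral)
  qed
  from this[OF v] this[OF w] have "(w - v) \<bullet> (w - v) = 0"
    by (simp add: inner_diff_left)
  then show "w = v" by simp
qed (rule v)

text \<open>The descent inequality, obtained by monotonicity along the segment from \<open>a\<close>
  to \<open>b\<close> instead of by integrating the gradient.\<close>

lemma gradient_lipschitz_upper_bound: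
  fixes E :: "'e::real_inner set"
  assumes E: "subspace E" and K: "convex K" "K \<subseteq> E"
    and D: "\<And>y. y \<in> K \<Longrightarrow> has_gradient_in E f (G y) y" and G: "L-lipschitz_on K G"
    and a: "a \<in> K" and b: "b \<in> K"
  shows "f b \<le> f a + G a \<bullet> (b - a) + L / 2 * (norm (b - a))\<^sup>2"
proof -
  define h where "h = b - a"
  have h: "h \<in> E" using a b K E by (auto simp: h_def intro: subspace_diff)
  \<comment> \<open>The gap between \<open>f\<close> on the segment and its claimed bound, up to the
    constant \<open>f a\<close>. Since \<psi> 0 is \<open>f a\<close>, the claim is exactly that
    \<psi> does not increase from 0 to 1; Cauchy-Schwarz and the Lipschitz bound make its derivative
    nonpositive.\<close>
  define \<psi> where "\<psi> t = f (a + t *\<^sub>R h) - t * (G a \<bullet> h) - L / 2 * t\<^sup>2 * (norm h)\<^sup>2" for t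
  have "\<psi> 1 \<le> \<psi> 0"
  proof (rule DERIV_nonpos_imp_nonincreasing[of 0 1 \<psi>])
    fix t :: real assume t: "0 \<le> t" "t \<le> 1"
    define c where "c = a + t *\<^sub>R h"
    have "c = (1 - t) *\<^sub>R a + t *\<^sub>R b" by (simp add: c_def h_def algebra_simps)
    then have c: "c \<in> K" using convexD_alt[OF K(1) a b t] by simp
    have "((\<lambda>s. f (a + s *\<^sub>R h)) has_real_derivative G c \<bullet> h) (at t)"
      using has_gradient_in_line[OF E _ h] D[OF c] a K by (auto simp: c_def)
    then have "DERIV \<psi> t :> G c \<bullet> h - G a \<bullet> h - L * t * (norm h)\<^sup>2"
      unfolding \<psi>_def by (auto intro!: derivative_eq_intros)
    moreover have "(G c - G a) \<bullet> h \<le> L * t * (norm h)\<^sup>2"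
    proof -
      have "(G c - G a) \<bullet> h \<le> norm (G c - G a) * norm h" by (rule norm_cauchy_schwarz)
      also have "\<dots> \<le> (L * norm (c - a)) * norm h"
        using lipschitz_onD[OF G c a] by (intro mult_right_mono) (auto simp: dist_norm)
      finally show ?thesis using t by (simp add: c_def power2_eq_square mult.assoc)
    qed
    ultimately show "\<exists>y. DERIV \<psi> t :> y \<and> y \<le> 0"
      by (auto simp: inner_diff_left)
  qed simp
  then show ?thesis by (simp add: \<psi>_def h_def)
qed

section \<open>Minkowski averages and their convex hulls\<close>

lemma mink_avg_eq:
  "mink_avg X g j = (*\<^sub>R) (1 / real CARD('n)) ` (\<Sum>i\<in>UNIV. g i j ` X i)"
  for X :: "'n::finite \<Rightarrow> 'x set"
  by (auto simp: mink_avg_def set_sum_alt)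

text \<open>Convex hulls commute with finite Minkowski sums and with scaling. This places both the
  averaged samples and the averaged means in the set where \<open>f j\<close> is controlled.\<close>

lemma average_in_convex_hull_mink_avg:
  fixes X :: "'n::finite \<Rightarrow> 'x set"
  assumes "\<And>i. z i \<in> convex hull (g i j ` X i)"
  shows "(1 / real CARD('n)) *\<^sub>R (\<Sum>i\<in>UNIV. z i) \<in> convex hull mink_avg X g j"
proof -
  have "(\<Sum>i\<in>UNIV. z i) \<in> convex hull (\<Sum>i\<in>UNIV. g i j ` X i)"
    unfolding convex_hull_set_sum using assms by (auto simp: set_sum_alt)
  then show ?thesis
    unfolding mink_avg_eq convex_hull_scaling by blast
qed

lemma bounded_mink_avg:
  fixes g :: "'n::finite \<Rightarrow> 'm \<Rightarrow> 'x \<Rightarrow> 'e::real_normed_vector"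
  assumes "\<And>i. bounded (g i j ` X i)"
  shows "bounded (mink_avg X g j)"
proof -
  have "\<forall>i. \<exists>B. \<forall>y\<in>g i j ` X i. norm y \<le> B" using assms by (auto simp: bounded_iff)
  then obtain B where B: "\<And>i y. y \<in> g i j ` X i \<Longrightarrow> norm y \<le> B i" by metis
  have "norm (\<Sum>i\<in>UNIV. s i) \<le> (\<Sum>i\<in>UNIV. B i)" if "\<forall>i. s i \<in> g i j ` X i" for s
    by (rule order_trans[OF norm_sum sum_mono]) (use B that in blast)
  then have "bounded (\<Sum>i\<in>UNIV. g i j ` X i)"
    unfolding bounded_iff set_sum_alt[OF finite] by blast
  then show ?thesis unfolding mink_avg_eq by (rule bounded_scaling)
qed

lemma convex_hull_mink_avg_subset:
  fixes X :: "'n::finite \<Rightarrow> 'x set"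
  assumes "subspace E" "\<And>i. g i j \<in> X i \<rightarrow> E"
  shows "convex hull mink_avg X g j \<subseteq> E"
proof (rule hull_minimal)
  show "mink_avg X g j \<subseteq> E"
  proof
    fix y assume "y \<in> mink_avg X g j"
    then obtain s where y: "y = (1 / real CARD('n)) *\<^sub>R (\<Sum>i\<in>UNIV. s i)"
      and "\<forall>i. s i \<in> g i j ` X i" by (auto simp: mink_avg_def)
    then have "s i \<in> E" for i using funcset_image[OF assms(2)] by blast
    then show "y \<in> E" unfolding y by (intro subspace_scale subspace_sum assms(1))
  qed
qed (rule subspace_imp_convex[OF assms(1)])

text \<open>On a bounded set, values differ from the value at one fixed point by at most
  \<open>L\<close> times a radius. Applied to the hull of \<open>mink_avg\<close>, this yields
  integrability of the cost and its lower bound.\<close>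

lemma lipschitz_on_bounded_image:
  fixes f :: "'e::metric_space \<Rightarrow> real"
  assumes f: "L-lipschitz_on K f" and K: "bounded K"
  shows "bounded (f ` K)"
proof (cases "K = {}")
  case False
  then obtain a where a: "a \<in> K" by blast
  from K obtain B where "\<And>y. y \<in> K \<Longrightarrow> dist a y \<le> B" by (meson bounded_any_center)
  then have "dist (f a) (f y) \<le> L * B" if "y \<in> K" for y
    using lipschitz_onD[OF f a that] lipschitz_on_nonneg[OF f] that
    by (meson mult_left_mono order_trans)
  then show ?thesis unfolding bounded_def by blast
qed simp

section \<open>Mean and variance of finitely supported measures\<close>

lemma mean_in_convex_hull:
  assumes "\<mu> \<in> fin_pmfs A"
  shows "mean \<mu> F \<in> convex hull (F ` A)"
  unfolding mean_def using assms
  by (intro convex_sum convex_convex_hull sum_pmf_eq_1) (auto simp: fin_pmfs_def intro: hull_inc)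

lemma sum_pmf_diff_mean:
  assumes "finite (set_pmf \<mu>)"
  shows "(\<Sum>x\<in>set_pmf \<mu>. pmf \<mu> x *\<^sub>R (F x - mean \<mu> F)) = 0"
  using sum_pmf_eq_1[OF assms order_refl]
  by (simp add: scaleR_diff_right sum_subtractf mean_def flip: scaleR_sum_left)

text \<open>A ball around \<open>F x\<close> with the diameter as radius contains the image of
  \<open>A\<close> and is convex, hence contains the mean too. So each squared deviation is at most
  the squared diameter, and the weights sum to one.\<close>

lemma var_le_diameter:
  fixes F :: "'x \<Rightarrow> 'h::real_inner"
  assumes \<mu>: "\<mu> \<in> fin_pmfs A" and A: "bounded (F ` A)"
  shows "var \<mu> F \<le> (diameter (F ` A))\<^sup>2"
proof -
  have fin: "finite (set_pmf \<mu>)" and sub: "set_pmf \<mu> \<subseteq> A" using \<mu> by (auto simp: fin_pmfs_def)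
  note one = sum_pmf_eq_1[OF fin order_refl]
  have "(norm (F x - mean \<mu> F))\<^sup>2 \<le> (diameter (F ` A))\<^sup>2" if "x \<in> A" for x
  proof -
    have "F ` A \<subseteq> cball (F x) (diameter (F ` A))"
      using diameter_bounded_bound[OF A] that by auto
    then have "convex hull (F ` A) \<subseteq> cball (F x) (diameter (F ` A))"
      by (rule hull_minimal) (rule convex_cball)
    then show ?thesis
      using mean_in_convex_hull[OF \<mu>, of F] by (intro power_mono) (auto simp: dist_norm)
  qed
  then have "var \<mu> F \<le> (\<Sum>x\<in>set_pmf \<mu>. pmf \<mu> x * (diameter (F ` A))\<^sup>2)"
    unfolding var_def using sub by (intro sum_mono mult_left_mono) auto
  then show ?thesis using one by (simp flip: sum_distrib_right)
qed

text \<open>Averages in the product space are taken componentwise, so the estimates can be made for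
  one \<open>j\<close> at a time.\<close>

lemma cost_eq:
  fixes g :: "'n::finite \<Rightarrow> 'm::finite \<Rightarrow> 'x \<Rightarrow> 'e::real_inner"
  shows "cost f g x = (\<Sum>j\<in>UNIV. f j ((1 / real CARD('n)) *\<^sub>R (\<Sum>i\<in>UNIV. g i j (x i))))"
  by (simp add: cost_def separable_sum_def gvec_def)

lemma rand_cost_eq:
  fixes g :: "'n::finite \<Rightarrow> 'm::finite \<Rightarrow> 'x \<Rightarrow> 'e::real_inner"
  shows "rand_cost f g \<mu> = (\<Sum>j\<in>UNIV. f j ((1 / real CARD('n)) *\<^sub>R (\<Sum>i\<in>UNIV. mean (\<mu> i) (g i j))))"
  by (simp add: rand_cost_def separable_sum_def gvec_def mean_def)

section \<open>Expectations under finitely supported laws and independence\<close>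

lemma (in prob_space)
  fixes F :: "'x \<Rightarrow> real"
  assumes X: "X \<in> M \<rightarrow>\<^sub>M count_space A" and D: "distr M (count_space UNIV) X = measure_pmf \<mu>"
    and fin: "finite (set_pmf \<mu>)"
  shows integrable_fin_distr: "integrable M (\<lambda>\<omega>. F (X \<omega>))"
    and expectation_fin_distr: "expectation (\<lambda>\<omega>. F (X \<omega>)) = (\<Sum>x\<in>set_pmf \<mu>. pmf \<mu> x * F x)"
proof -
  have X': "X \<in> M \<rightarrow>\<^sub>M count_space UNIV"
    using measurable_compose[OF X, of "\<lambda>x. x" "count_space UNIV"] by simp
  have "integrable (distr M (count_space UNIV) X) F"
    unfolding D using fin by (rule integrable_measure_pmf_finite)
  then show "integrable M (\<lambda>\<omega>. F (X \<omega>))"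
    by (subst (asm) integrable_distr_eq[OF X']) auto
  have "expectation (\<lambda>\<omega>. F (X \<omega>)) = integral\<^sup>L (distr M (count_space UNIV) X) F"
    by (rule integral_distr[OF X', symmetric]) simp
  also have "\<dots> = (\<Sum>x\<in>set_pmf \<mu>. pmf \<mu> x * F x)"
    unfolding D by (subst integral_measure_pmf[OF fin]) auto
  finally show "expectation (\<lambda>\<omega>. F (X \<omega>)) = (\<Sum>x\<in>set_pmf \<mu>. pmf \<mu> x * F x)" .
qed

text \<open>
  Only real integrals of inner products are used, since the sort of \<open>'e\<close> does not entail the class
  \<open>banach\<close> required for Bochner integrals with values in \<open>'e\<close>.
\<close>

lemma (in prob_space)
  fixes F H :: "'x \<Rightarrow> 'e::{real_inner, second_countable_topology}"
  assumes X: "indep_vars (\<lambda>i. count_space (A i)) X UNIV"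
    and D: "\<And>i. distr M (count_space UNIV) (X i) = measure_pmf (\<mu> i)"
    and fin: "\<And>i. finite (set_pmf (\<mu> i))" and ik: "i \<noteq> k"
  shows integrable_inner_indep: "integrable M (\<lambda>\<omega>. F (X i \<omega>) \<bullet> H (X k \<omega>))" (is ?int)
    and expectation_inner_indep:
      "expectation (\<lambda>\<omega>. F (X i \<omega>) \<bullet> H (X k \<omega>)) = mean (\<mu> i) F \<bullet> mean (\<mu> k) H" (is ?exp)
proof -
  have meas: "X l \<in> M \<rightarrow>\<^sub>M count_space (A l)" for l
    using X by (simp add: indep_vars_def2)
  have meas': "(\<lambda>\<omega>. T (X l \<omega>)) \<in> borel_measurable M" for l and T :: "'x \<Rightarrow> 'e"
    by (rule measurable_compose[OF meas]) simp
  note int1 = integrable_fin_distr[OF meas D fin]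
  note exp1 = expectation_fin_distr[OF meas D fin]
  let ?S = "set_pmf (\<mu> i)"
  \<comment> \<open>The inner product is expanded over the values \<open>x\<close> of
    \<open>X i\<close>. Each \<open>?t x\<close> is a product of a real function of
    \<open>X i\<close> and a real function of \<open>X k\<close>, so independence of real variables
    applies to it.\<close>
  let ?t = "\<lambda>x \<omega>. indicator {x} (X i \<omega>) * (F x \<bullet> H (X k \<omega>))"
  have t: "integrable M (?t x)"
    "expectation (?t x) = pmf (\<mu> i) x * (F x \<bullet> mean (\<mu> k) H)" if "x \<in> ?S" for x
  proof -
    \<comment> \<open>Both factors of \<open>?t x\<close> as one family, the form in which the
      product rules for independent variables are stated.\<close>
    define Y where "Y l y = (if l = i then indicator {x} y else F x \<bullet> H y)" for l y
    have ind: "indep_vars (\<lambda>_. borel) (\<lambda>l \<omega>. Y l (X l \<omega>)) {i, k}"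
      by (rule indep_vars_compose2[OF indep_vars_subset[OF X]]) auto
    have int: "integrable M (\<lambda>\<omega>. Y l (X l \<omega>))" for l
      by (rule int1)
    have eq: "(\<lambda>\<omega>. \<Prod>l\<in>{i, k}. Y l (X l \<omega>)) = ?t x"
      using ik by (simp add: Y_def)
    show "integrable M (?t x)"
      using indep_vars_integrable[OF _ ind int] eq by simp
    have "expectation (?t x) = (\<Prod>l\<in>{i, k}. expectation (\<lambda>\<omega>. Y l (X l \<omega>)))"
      using indep_vars_lebesgue_integral[OF _ ind int] eq by simp
    also have "\<dots> = expectation (\<lambda>\<omega>. indicator {x} (X i \<omega>)) * expectation (\<lambda>\<omega>. F x \<bullet> H (X k \<omega>))"
      using ik by (simp add: Y_def)
    also have "expectation (\<lambda>\<omega>. indicator {x} (X i \<omega>)) = pmf (\<mu> i) x"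
      using that fin by (subst exp1[where F = "indicator {x}"]) (simp add: indicator_def of_bool_def if_distrib[of "\<lambda>c. _ * c"] cong: if_cong)
    also have "expectation (\<lambda>\<omega>. F x \<bullet> H (X k \<omega>)) = F x \<bullet> mean (\<mu> k) H"
      by (subst exp1[where F = "\<lambda>y. F x \<bullet> H y"]) (simp add: mean_def inner_sum_right)
    finally show "expectation (?t x) = pmf (\<mu> i) x * (F x \<bullet> mean (\<mu> k) H)" .
  qed
  \<comment> \<open>The expansion over the support recovers the inner product only where
    \<open>X i\<close> hits the support, hence almost surely.\<close>
  have "AE \<omega> in M. X i \<omega> \<in> ?S"
  proof -
    have m: "X i \<in> M \<rightarrow>\<^sub>M count_space UNIV"
      using measurable_compose[OF meas[of i], of "\<lambda>x. x" "count_space UNIV"] by simp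
    have "AE x in distr M (count_space UNIV) (X i). x \<in> ?S"
      unfolding D by (rule AE_measure_pmf)
    then show ?thesis by (rule AE_distrD[OF m])
  qed
  then have ae: "AE \<omega> in M. (\<Sum>x\<in>?S. ?t x \<omega>) = F (X i \<omega>) \<bullet> H (X k \<omega>)"
    by eventually_elim (simp add: fin indicator_def of_bool_def if_distrib[of "\<lambda>c. c * _"] cong: if_cong)
  have m: "(\<lambda>\<omega>. F (X i \<omega>) \<bullet> H (X k \<omega>)) \<in> borel_measurable M"
    by (intro borel_measurable_inner meas')
  have s: "integrable M (\<lambda>\<omega>. \<Sum>x\<in>?S. ?t x \<omega>)"
    using t(1) by (rule Bochner_Integration.integrable_sum)
  show ?int
    using s m ae by (rule integrable_cong_AE_imp)
  have "expectation (\<lambda>\<omega>. F (X i \<omega>) \<bullet> H (X k \<omega>)) = expectation (\<lambda>\<omega>. \<Sum>x\<in>?S. ?t x \<omega>)"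
    using ae s m by (intro integral_cong_AE) auto
  also have "\<dots> = (\<Sum>x\<in>?S. pmf (\<mu> i) x * (F x \<bullet> mean (\<mu> k) H))"
    using t by (simp add: Bochner_Integration.integral_sum)
  also have "\<dots> = mean (\<mu> i) F \<bullet> mean (\<mu> k) H"
    by (simp add: mean_def inner_sum_left)
  finally show ?exp .
qed

text \<open>Bienayme's identity. The squared norm is a double sum of inner products of the centred
  variables \<open>Z i\<close>; off the diagonal the expectation is an inner product of zero means,
  on the diagonal it is a variance.\<close>

lemma (in prob_space)
  fixes F :: "'n::finite \<Rightarrow> 'x \<Rightarrow> 'e::{real_inner, second_countable_topology}"
  assumes X: "indep_vars (\<lambda>i. count_space (A i)) X UNIV"
    and D: "\<And>i. distr M (count_space UNIV) (X i) = measure_pmf (\<mu> i)"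
    and fin: "\<And>i. finite (set_pmf (\<mu> i))"
  shows integrable_norm_sum_indep:
      "integrable M (\<lambda>\<omega>. (norm (\<Sum>i\<in>UNIV. F i (X i \<omega>) - mean (\<mu> i) (F i)))\<^sup>2)" (is ?int)
    and expectation_norm_sum_indep:
      "expectation (\<lambda>\<omega>. (norm (\<Sum>i\<in>UNIV. F i (X i \<omega>) - mean (\<mu> i) (F i)))\<^sup>2) =
        (\<Sum>i\<in>UNIV. var (\<mu> i) (F i))" (is ?exp)
proof -
  have meas: "X l \<in> M \<rightarrow>\<^sub>M count_space (A l)" for l
    using X by (simp add: indep_vars_def2)
  define Z where "Z i x = F i x - mean (\<mu> i) (F i)" for i x
  have Z0: "mean (\<mu> i) (Z i) = 0" for i
    using sum_pmf_diff_mean[OF fin] by (simp add: mean_def[of _ "Z i"] Z_def)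
  have int: "integrable M (\<lambda>\<omega>. Z i (X i \<omega>) \<bullet> Z k (X k \<omega>))" for i k
    using integrable_inner_indep[OF X D fin] integrable_fin_distr[OF meas D fin, of "\<lambda>x. Z i x \<bullet> Z i x"]
    by (cases "i = k") auto
  have ex: "expectation (\<lambda>\<omega>. Z i (X i \<omega>) \<bullet> Z k (X k \<omega>)) = (if i = k then var (\<mu> i) (F i) else 0)" for i k
    using expectation_inner_indep[OF X D fin, of i k "Z i" "Z k"]
      expectation_fin_distr[OF meas D fin, of "\<lambda>x. Z i x \<bullet> Z i x"]
    by (cases "i = k") (auto simp: Z0 var_def power2_norm_eq_inner, simp_all add: Z_def)
  have eq: "(norm (\<Sum>i\<in>UNIV. F i (X i \<omega>) - mean (\<mu> i) (F i)))\<^sup>2 =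
      (\<Sum>i\<in>UNIV. \<Sum>k\<in>UNIV. Z i (X i \<omega>) \<bullet> Z k (X k \<omega>))" for \<omega>
    unfolding power2_norm_eq_inner inner_sum_left inner_sum_right Z_def by (rule sum.swap)
  show ?int
    unfolding eq by (intro Bochner_Integration.integrable_sum int)
  show ?exp
    unfolding eq by (simp add: int ex)
qed

section \<open>The bound in expectation, for one component and for the cost\<close>

lemma (in prob_space)
  fixes X :: "'n::finite \<Rightarrow> 'a \<Rightarrow> 'x"
    and g :: "'n \<Rightarrow> 'm \<Rightarrow> 'x \<Rightarrow> 'e::{real_inner, second_countable_topology}"
  assumes X: "indep_vars (\<lambda>i. count_space (A i)) X UNIV"
    and D: "\<And>i. distr M (count_space UNIV) (X i) = measure_pmf (\<mu> i)"
    and \<mu>: "\<And>i. \<mu> i \<in> fin_pmfs (A i)"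
    and E: "subspace E" "\<And>i. g i j \<in> A i \<rightarrow> E" and A: "\<And>i. bounded (g i j ` A i)"
    and f: "L-lipschitz_on (convex hull mink_avg A g j) f"
    and C1: "C1_on_nbhd_in E (convex hull mink_avg A g j) f"
    and f': "L'-lipschitz_on (convex hull mink_avg A g j) (gradient_in E f)"
  shows integrable_smooth_average:
      "integrable M (\<lambda>\<omega>. f ((1 / real CARD('n)) *\<^sub>R (\<Sum>i\<in>UNIV. g i j (X i \<omega>))))" (is "integrable M ?fY")
    and expectation_smooth_average_le:
      "expectation (\<lambda>\<omega>. f ((1 / real CARD('n)) *\<^sub>R (\<Sum>i\<in>UNIV. g i j (X i \<omega>)))) \<le>
        f ((1 / real CARD('n)) *\<^sub>R (\<Sum>i\<in>UNIV. mean (\<mu> i) (g i j))) +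
        1 / (2 * (real CARD('n))\<^sup>2) * (L' * (\<Sum>i\<in>UNIV. var (\<mu> i) (g i j)))"
proof -
  let ?N = "real CARD('n)"
  let ?K = "convex hull mink_avg A g j"
  let ?G = "gradient_in E f"
  let ?Y = "\<lambda>\<omega>. (1 / ?N) *\<^sub>R (\<Sum>i\<in>UNIV. g i j (X i \<omega>))"
  define m where "m = (1 / ?N) *\<^sub>R (\<Sum>i\<in>UNIV. mean (\<mu> i) (g i j))"
  have fin: "finite (set_pmf (\<mu> i))" for i using \<mu> by (auto simp: fin_pmfs_def)
  have meas: "X l \<in> M \<rightarrow>\<^sub>M count_space (A l)" for l
    using X by (simp add: indep_vars_def2)
  \<comment> \<open>This holds at every sample point, because measurability into
    \<open>count_space (A l)\<close> forces \<open>X l\<close> to take values in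
    \<open>A l\<close>.\<close>
  have Y_in: "?Y \<omega> \<in> ?K" if "\<omega> \<in> space M" for \<omega>
    using measurable_space[OF meas that]
    by (intro average_in_convex_hull_mink_avg hull_inc imageI) auto
  have m_in: "m \<in> ?K"
    unfolding m_def by (intro average_in_convex_hull_mink_avg mean_in_convex_hull \<mu>)
  have KE: "?K \<subseteq> E" by (intro convex_hull_mink_avg_subset E)
  \<comment> \<open>\<open>f\<close> is only known to be continuous on the hull, which need not be a Borel set\<close>
  have "?Y \<in> borel_measurable M"
    by (intro borel_measurable_scaleR borel_measurable_sum measurable_compose[OF meas]) auto
  then have "?Y \<in> M \<rightarrow>\<^sub>M restrict_space borel ?K"
    using Y_in by (intro measurable_restrict_space2) auto
  moreover have "f \<in> borel_measurable (restrict_space borel ?K)"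
    by (intro borel_measurable_continuous_on_restrict lipschitz_on_continuous_on[OF f])
  ultimately have fY: "?fY \<in> borel_measurable M"
    by (rule measurable_compose)
  \<comment> \<open>Integrability comes from boundedness on a probability space.\<close>
  have "bounded (f ` ?K)"
    by (intro lipschitz_on_bounded_image[OF f] bounded_convex_hull bounded_mink_avg A)
  then obtain B where "\<And>y. y \<in> ?K \<Longrightarrow> norm (f y) \<le> B" by (auto simp: bounded_iff)
  then show int_fY: "integrable M ?fY"
    using Y_in fY by (intro integrable_const_bound[where B = B]) auto
  let ?Z = "\<lambda>\<omega>. \<Sum>i\<in>UNIV. g i j (X i \<omega>) - mean (\<mu> i) (g i j)"
  have Ym: "?Y \<omega> - m = (1 / ?N) *\<^sub>R ?Z \<omega>" for \<omega>
    by (simp add: m_def sum_subtractf scaleR_diff_right)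
  \<comment> \<open>The C1 hypothesis supplies some gradient at each point of the hull; uniqueness
    within \<open>E\<close> identifies it with \<open>gradient_in\<close>.\<close>
  have grad: "has_gradient_in E f (?G y) y" if "y \<in> ?K" for y
    using C1 that KE gradient_in_eq[OF E(1)] unfolding C1_on_nbhd_in_def by (metis subsetD)
  \<comment> \<open>The descent bound at base point \<open>m\<close> with increment
    \<open>?Z\<close> divided by \<open>?N\<close>, hence the coefficients of the linear and the
    quadratic term.\<close>
  let ?R = "\<lambda>\<omega>. f m + (1 / ?N) * (?G m \<bullet> ?Z \<omega>) + L' / (2 * ?N\<^sup>2) * (norm (?Z \<omega>))\<^sup>2"
  have le: "?fY \<omega> \<le> ?R \<omega>" if "\<omega> \<in> space M" for \<omega>
    using gradient_lipschitz_upper_bound[OF E(1) convex_convex_hull KE grad f' m_in Y_in[OF that]]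
    unfolding Ym by (simp add: power_mult_distrib power_divide)
  have lin_int: "integrable M (\<lambda>\<omega>. ?G m \<bullet> (g i j (X i \<omega>) - mean (\<mu> i) (g i j)))" for i
    by (rule integrable_fin_distr[OF meas D fin])
  have lin: "expectation (\<lambda>\<omega>. ?G m \<bullet> (g i j (X i \<omega>) - mean (\<mu> i) (g i j))) = 0" for i
  proof -
    have "expectation (\<lambda>\<omega>. ?G m \<bullet> (g i j (X i \<omega>) - mean (\<mu> i) (g i j))) =
      ?G m \<bullet> (\<Sum>x\<in>set_pmf (\<mu> i). pmf (\<mu> i) x *\<^sub>R (g i j x - mean (\<mu> i) (g i j)))"
      using expectation_fin_distr[OF meas D fin, of "\<lambda>x. ?G m \<bullet> (g i j x - mean (\<mu> i) (g i j))" i]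
      by (simp add: inner_sum_right)
    then show ?thesis by (simp add: sum_pmf_diff_mean[OF fin])
  qed
  have int_lin: "integrable M (\<lambda>\<omega>. ?G m \<bullet> ?Z \<omega>)"
    unfolding inner_sum_right by (intro Bochner_Integration.integrable_sum lin_int)
  have exp_lin: "expectation (\<lambda>\<omega>. ?G m \<bullet> ?Z \<omega>) = 0"
    unfolding inner_sum_right by (subst Bochner_Integration.integral_sum) (simp_all only: lin_int lin sum.neutral_const)
  note sq = integrable_norm_sum_indep[OF X D fin, of "\<lambda>i. g i j"]
    expectation_norm_sum_indep[OF X D fin, of "\<lambda>i. g i j"]
  have "expectation ?fY \<le> expectation ?R"
    using int_fY int_lin sq(1) le by (intro integral_mono) auto
  also have "\<dots> = f m + L' / (2 * ?N\<^sup>2) * (\<Sum>i\<in>UNIV. var (\<mu> i) (g i j))"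
    using int_lin exp_lin sq by (simp add: prob_space)
  finally show "expectation ?fY \<le> f ((1 / ?N) *\<^sub>R (\<Sum>i\<in>UNIV. mean (\<mu> i) (g i j))) +
      1 / (2 * ?N\<^sup>2) * (L' * (\<Sum>i\<in>UNIV. var (\<mu> i) (g i j)))"
    by (simp add: m_def)
qed

lemma (in prob_space)
  fixes X :: "'n::finite \<Rightarrow> 'a \<Rightarrow> 'x"
    and E :: "'m::finite \<Rightarrow> 'e::{real_inner, second_countable_topology} set"
  assumes E: "\<And>j. subspace (E j)" "\<And>i j. g i j \<in> A i \<rightarrow> E j"
    and ass: "assumption1 A E f g L L'"
    and \<mu>: "\<And>i. \<mu> i \<in> fin_pmfs (A i)"
    and X: "indep_vars (\<lambda>i. count_space (A i)) X UNIV"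
    and D: "\<And>i. distr M (count_space UNIV) (X i) = measure_pmf (\<mu> i)"
  shows integrable_cost: "integrable M (\<lambda>\<omega>. cost f g (\<lambda>i. X i \<omega>))" (is ?int)
    and expectation_cost_le: "expectation (\<lambda>\<omega>. cost f g (\<lambda>i. X i \<omega>)) \<le> rand_cost f g \<mu> +
      1 / (2 * (real CARD('n))\<^sup>2) * (\<Sum>j\<in>UNIV. L' j * (\<Sum>i\<in>UNIV. var (\<mu> i) (g i j)))" (is ?le)
proof -
  have ass': "bounded (g i j ` A i)" "(L j)-lipschitz_on (convex hull mink_avg A g j) (f j)"
    "C1_on_nbhd_in (E j) (convex hull mink_avg A g j) (f j)"
    "(L' j)-lipschitz_on (convex hull mink_avg A g j) (gradient_in (E j) (f j))" for i j
    using ass by (auto simp: assumption1_def)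
  note int = integrable_smooth_average[OF X D \<mu> E ass']
    and le = expectation_smooth_average_le[OF X D \<mu> E ass']
  show ?int unfolding cost_eq by (intro Bochner_Integration.integrable_sum int)
  show ?le
    unfolding cost_eq rand_cost_eq sum_distrib_left Bochner_Integration.integral_sum[OF int] sum.distrib[symmetric]
    by (intro sum_mono) (use le in \<open>simp add: sum_distrib_left\<close>)
qed

text \<open>Lipschitz constants are nonnegative, so the variance bounds can be multiplied by
  \<open>L' j\<close>. One of the two factors \<open>1 / N\<close> is absorbed into
  \<open>C1_const\<close>.\<close>

lemma var_sum_le_C1_const:
  fixes A :: "'n::finite \<Rightarrow> 'x set" and E :: "'m::finite \<Rightarrow> 'e::real_inner set"
  assumes ass: "assumption1 A E f g L L'" and \<mu>: "\<And>i. \<mu> i \<in> fin_pmfs (A i)"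
  shows "1 / (2 * (real CARD('n))\<^sup>2) * (\<Sum>j\<in>UNIV. L' j * (\<Sum>i\<in>UNIV. var (\<mu> i) (g i j)))
    \<le> C1_const A g L' / (2 * real CARD('n))"
proof -
  have "(\<Sum>j\<in>UNIV. L' j * (\<Sum>i\<in>UNIV. var (\<mu> i) (g i j))) \<le>
    (\<Sum>j\<in>UNIV. L' j * (\<Sum>i\<in>UNIV. (diameter (g i j ` A i))\<^sup>2))"
    using ass
    by (intro sum_mono mult_left_mono var_le_diameter \<mu>) (auto simp: assumption1_def intro: lipschitz_on_nonneg)
  from divide_right_mono[OF this, of "2 * (real CARD('n))\<^sup>2"] show ?thesis
    by (simp add: C1_const_def power2_eq_square[of "real CARD('n)"] mult.left_commute)
qed

section \<open>Comparison of the two infima\<close>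

text \<open>Makes the real infimum in \<open>opt_cost\<close> an actual lower bound: every argument
  of \<open>f j\<close> lies in a bounded hull, where \<open>f j\<close> is bounded.\<close>

lemma bdd_below_cost:
  fixes A :: "'n::finite \<Rightarrow> 'x set" and E :: "'m::finite \<Rightarrow> 'e::real_inner set"
  assumes ass: "assumption1 A E f g L L'"
  shows "bdd_below (cost f g ` (\<Pi> i\<in>UNIV. A i))"
proof -
  have "bounded (f j ` (convex hull mink_avg A g j))" for j
    using ass
    by (intro lipschitz_on_bounded_image[of "L j"] bounded_convex_hull bounded_mink_avg)
      (auto simp: assumption1_def)
  then have "\<forall>j. \<exists>B. \<forall>y\<in>convex hull mink_avg A g j. B \<le> f j y"
    using bounded_imp_bdd_below unfolding bdd_below_def by fastforce
  then obtain B where B: "\<And>j y. y \<in> convex hull mink_avg A g j \<Longrightarrow> B j \<le> f j y" by metis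
  then show ?thesis
    unfolding cost_eq
    by (intro bdd_belowI2[where m = "\<Sum>j\<in>UNIV. B j"] sum_mono)
      (auto simp: Pi_iff intro!: B average_in_convex_hull_mink_avg intro: hull_inc)
qed

text \<open>The comparison of infima starts from \<mu> alone, so independent variables with these
  laws must be constructed: coordinates under the product measure.\<close>

lemma ex_indep_vars_fin_pmfs:
  fixes \<mu> :: "'n::finite \<Rightarrow> 'x pmf"
  assumes \<mu>: "\<And>i. \<mu> i \<in> fin_pmfs (A i)"
  obtains P :: "('n \<Rightarrow> 'x) measure" and X where "prob_space P"
    "prob_space.indep_vars P (\<lambda>i. count_space (A i)) X UNIV"
    "\<And>i. distr P (count_space UNIV) (X i) = measure_pmf (\<mu> i)"
proof -
  define p where "p = Pi_pmf UNIV undefined \<mu>"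
  have sub: "set_pmf (\<mu> i) \<subseteq> A i" for i using \<mu> by (auto simp: fin_pmfs_def)
  then have "\<exists>x. x \<in> A i" for i using set_pmf_not_empty[of "\<mu> i"] by fast
  then obtain x0 where x0: "\<And>i. x0 i \<in> A i" by metis
  \<comment> \<open>the coordinates are corrected on a null set so as to take values in \<open>A i\<close> surely\<close>
  define h where "h i x = (if x \<in> A i then x else x0 i)" for i x
  have "prob_space.indep_vars p (\<lambda>i. count_space UNIV) (\<lambda>i \<omega>. \<omega> i) UNIV"
    unfolding p_def by (rule indep_vars_Pi_pmf) simp
  then have "prob_space.indep_vars p (\<lambda>i. count_space (A i)) (\<lambda>i \<omega>. h i (\<omega> i)) UNIV"
    by (rule prob_space.indep_vars_compose2[OF prob_space_measure_pmf]) (auto simp: h_def x0)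
  moreover have "distr p (count_space UNIV) (\<lambda>\<omega>. h i (\<omega> i)) = measure_pmf (\<mu> i)" for i
  proof -
    have "map_pmf (\<lambda>\<omega>. h i (\<omega> i)) p = map_pmf (h i) (map_pmf (\<lambda>\<omega>. \<omega> i) p)"
      by (simp add: pmf.map_comp o_def)
    also have "\<dots> = map_pmf (h i) (\<mu> i)" by (simp add: p_def Pi_pmf_component)
    \<comment> \<open>The correction \<open>h i\<close> is the identity on the support, so it
      preserves the law.\<close>
    also have "\<dots> = \<mu> i"
      using sub[of i] by (intro map_pmf_idI) (auto simp: h_def)
    finally show ?thesis by (metis map_pmf_rep_eq)
  qed
  ultimately show thesis
    using that[OF prob_space_measure_pmf] by blast
qed

theorem proposition2p6:
  fixes Xs :: "'n::finite \<Rightarrow> 'x set"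
    and E :: "'m::finite \<Rightarrow> 'e::{real_inner, complete_space, second_countable_topology} set"
    and f :: "'m \<Rightarrow> 'e \<Rightarrow> real"
    and g :: "'n \<Rightarrow> 'm \<Rightarrow> 'x \<Rightarrow> 'e"
    and L L' :: "'m \<Rightarrow> real"
  assumes "\<forall>i. Xs i \<noteq> {}"
    and "\<forall>j. subspace (E j) \<and> closed (E j)"
    and "\<forall>i j. g i j \<in> Xs i \<rightarrow> E j"
    and "assumption1 Xs E f g L L'"
  shows "(\<forall>(\<mu> :: 'n \<Rightarrow> 'x pmf) (P :: 'w measure) (X :: 'n \<Rightarrow> 'w \<Rightarrow> 'x).
            (\<forall>i. \<mu> i \<in> fin_pmfs (Xs i)) \<longrightarrow>
            prob_space P \<longrightarrow>
            prob_space.indep_vars P (\<lambda>i. count_space (Xs i)) X UNIV \<longrightarrow>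
            (\<forall>i. distr P (count_space UNIV) (X i) = measure_pmf (\<mu> i)) \<longrightarrow>
              prob_space.expectation P (\<lambda>\<omega>. cost f g (\<lambda>i. X i \<omega>)) - rand_cost f g \<mu>
                \<le> 1 / (2 * (real CARD('n))\<^sup>2) *
                    (\<Sum>j\<in>UNIV. L' j * (\<Sum>i\<in>UNIV. var (\<mu> i) (g i j)))
            \<and> 1 / (2 * (real CARD('n))\<^sup>2) *
                    (\<Sum>j\<in>UNIV. L' j * (\<Sum>i\<in>UNIV. var (\<mu> i) (g i j)))
                \<le> C1_const Xs g L' / (2 * real CARD('n)))
       \<and> opt_cost Xs f g - opt_rand_cost Xs f g \<le> C1_const Xs g L' / (2 * real CARD('n))"
proof (intro conjI allI impI)
  fix \<mu> :: "'n \<Rightarrow> 'x pmf" and P :: "'w measure" and X :: "'n \<Rightarrow> 'w \<Rightarrow> 'x"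
  assume \<mu>: "\<forall>i. \<mu> i \<in> fin_pmfs (Xs i)" and "prob_space P"
    and X: "prob_space.indep_vars P (\<lambda>i. count_space (Xs i)) X UNIV"
    and D: "\<forall>i. distr P (count_space UNIV) (X i) = measure_pmf (\<mu> i)"
  interpret prob_space P by fact
  show "expectation (\<lambda>\<omega>. cost f g (\<lambda>i. X i \<omega>)) - rand_cost f g \<mu>
      \<le> 1 / (2 * (real CARD('n))\<^sup>2) * (\<Sum>j\<in>UNIV. L' j * (\<Sum>i\<in>UNIV. var (\<mu> i) (g i j)))"
    using expectation_cost_le[of E g Xs f L L' \<mu> X] assms \<mu> X D by simp
  show "1 / (2 * (real CARD('n))\<^sup>2) * (\<Sum>j\<in>UNIV. L' j * (\<Sum>i\<in>UNIV. var (\<mu> i) (g i j)))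
      \<le> C1_const Xs g L' / (2 * real CARD('n))"
    using assms(4) \<mu> by (intro var_sum_le_C1_const) auto
next
  \<comment> \<open>A bound uniform in \<mu>, ready for passing to the infimum.\<close>
  have "opt_cost Xs f g - C1_const Xs g L' / (2 * real CARD('n)) \<le> rand_cost f g \<mu>"
    if "\<mu> \<in> (\<Pi> i\<in>UNIV. fin_pmfs (Xs i))" for \<mu>
  proof -
    have \<mu>: "\<mu> i \<in> fin_pmfs (Xs i)" for i using that by auto
    \<comment> \<open>This space lives on functions from \<open>'n\<close> to \<open>'x\<close>, a
      type unrelated to \<open>'w\<close>; the expectation bound is therefore taken from the
      polymorphic lemma, not from the first conjunct.\<close>
    obtain P :: "('n \<Rightarrow> 'x) measure" and X where P: "prob_space P"
      and X: "prob_space.indep_vars P (\<lambda>i. count_space (Xs i)) X UNIV"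
      and D: "\<And>i. distr P (count_space UNIV) (X i) = measure_pmf (\<mu> i)"
      using ex_indep_vars_fin_pmfs[of \<mu> Xs] \<mu> by blast
    interpret prob_space P by (rule P)
    \<comment> \<open>Every realisation is admissible, so \<open>opt_cost\<close> bounds the random
      cost from below everywhere, and then its expectation.\<close>
    have "X i \<omega> \<in> Xs i" if "\<omega> \<in> space P" for i \<omega>
      using X measurable_space[OF _ that, of "X i" "count_space (Xs i)"] by (simp add: indep_vars_def2)
    then have "opt_cost Xs f g \<le> cost f g (\<lambda>i. X i \<omega>)" if "\<omega> \<in> space P" for \<omega>
      unfolding opt_cost_def using that by (intro cINF_lower bdd_below_cost[OF assms(4)]) auto
    then have "opt_cost Xs f g \<le> expectation (\<lambda>\<omega>. cost f g (\<lambda>i. X i \<omega>))"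
      using assms \<mu> X D by (intro integral_ge_const integrable_cost[of E g Xs f L L' \<mu>]) auto
    also have "\<dots> \<le> rand_cost f g \<mu> + 1 / (2 * (real CARD('n))\<^sup>2) *
        (\<Sum>j\<in>UNIV. L' j * (\<Sum>i\<in>UNIV. var (\<mu> i) (g i j)))"
      using assms \<mu> X D by (intro expectation_cost_le[of E]) auto
    finally show ?thesis
      using var_sum_le_C1_const[of Xs E f g L L' \<mu>] assms(4) \<mu> by simp
  qed
  \<comment> \<open>Dirac measures provide the nonemptiness that \<open>cINF_greatest\<close>
    requires for real infima.\<close>
  moreover have "(\<Pi> i\<in>UNIV. fin_pmfs (Xs i)) \<noteq> {}"
  proof -
    have "\<forall>i. \<exists>x. x \<in> Xs i" using assms(1) by blast
    then obtain x where "\<And>i. x i \<in> Xs i" by metis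
    then have "(\<lambda>i. return_pmf (x i)) \<in> (\<Pi> i\<in>UNIV. fin_pmfs (Xs i))" by (simp add: fin_pmfs_def)
    then show ?thesis by blast
  qed
  ultimately have "opt_cost Xs f g - C1_const Xs g L' / (2 * real CARD('n)) \<le> opt_rand_cost Xs f g"
    unfolding opt_rand_cost_def by (intro cINF_greatest)
  then show "opt_cost Xs f g - opt_rand_cost Xs f g \<le> C1_const Xs g L' / (2 * real CARD('n))"
    by simp
qed

end
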